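(* Let $n>3$ be odd and $m<n$ a positive integer with $\gcd(m,n)=\gcd(m-1,n)=1$. Then the neutrosophic loop $\langle L_n(m)\cup I\rangle$ is a weak inverse property (WIP) loop if and only if $m^2-m+1\equiv 0\pmod n$.
   Context: For $n>3$ odd and $m<n$ a positive integer with $\gcd(m,n)=\gcd(m-1,n)=1$, the loop $L_n(m)$ is the set $\{e,1,2,\dots,n\}$ with operation: $e\cdot i=i\cdot e=i$ for all $i$; $i\cdot i=e$ for all $i$; and for $i,j\in\{1,\dots,n\}$, $i\neq j$, $i\cdot j$ is the element $s\in\{1,\dots,n\}$ with $s\equiv mj-(m-1)i \pmod n$. The neutrosophic loop $\langle L_n(m)\cup I\rangle$ is the set $\{e,1,\dots,n,eI,1I,\dots,nI\}$ of $2(n+1)$ distinct symbols, with the product of $L_n(m)$ on $\{e,1,\dots,n\}$ and $x\cdot(yI)=(xI)\cdot y=(xI)\cdot(yI)=(x\cdot y)I$ for $x,y\in L_n(m)$; moreover $(xI)I=xI$. A neutrosophic loop is a WIP loop if for all its elements $x,y,z$: $(xy)z=e$ implies $x(yz)=e$, $(xI\cdot yI)\,zI=eI$ and $xI\,(yI\cdot zI)=eI$, where $e$ is the identity element of $L_n(m)$. *)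

theory Defs
  imports "HOL-Algebra.Group" "HOL-Number_Theory.Cong"
begin

text \<open>The record type \<open>monoid\<close> is used only as a carrier set with a multiplication
  and a unit; associativity is not assumed (the loops below are not associative).\<close>

datatype Ln_elem = E | Num nat

fun Ln_mult :: "nat \<Rightarrow> nat \<Rightarrow> Ln_elem \<Rightarrow> Ln_elem \<Rightarrow> Ln_elem" where
  "Ln_mult n m E y = y"
| "Ln_mult n m (Num i) E = Num i"
| "Ln_mult n m (Num i) (Num j) =
     (if i = j then E
      else Num (THE s. s \<in> {1..n} \<and>
             [int s = int m * int j - (int m - 1) * int i] (mod int n)))"

definition Ln :: "nat \<Rightarrow> nat \<Rightarrow> Ln_elem monoid" where
  "Ln n m = \<lparr>carrier = insert E (Num ` {1..n}), monoid.mult = Ln_mult n m, one = E\<rparr>"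

text \<open>\<open>Pure x\<close> stands for the element \<open>x\<close> of the loop, \<open>Ind x\<close> for the
  symbol \<open>xI\<close>, and \<open>times_I\<close> for multiplication by \<open>I\<close>, which satisfies \<open>(xI)I = xI\<close>.\<close>

datatype 'a neutro = Pure 'a | Ind 'a

fun times_I :: "'a neutro \<Rightarrow> 'a neutro" where
  "times_I (Pure x) = Ind x"
| "times_I (Ind x) = Ind x"

fun neutro_mult :: "('a \<Rightarrow> 'a \<Rightarrow> 'a) \<Rightarrow> 'a neutro \<Rightarrow> 'a neutro \<Rightarrow> 'a neutro" where
  "neutro_mult f (Pure x) (Pure y) = Pure (f x y)"
| "neutro_mult f (Pure x) (Ind y) = Ind (f x y)"
| "neutro_mult f (Ind x) (Pure y) = Ind (f x y)"
| "neutro_mult f (Ind x) (Ind y) = Ind (f x y)"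

definition neutrosophic_loop :: "'a monoid \<Rightarrow> 'a neutro monoid" where
  "neutrosophic_loop L =
     \<lparr>carrier = Pure ` carrier L \<union> Ind ` carrier L,
      monoid.mult = neutro_mult (monoid.mult L),
      one = Pure (one L)\<rparr>"

text \<open>The variables range over all elements, including those of the form \<open>aI\<close>.\<close>

definition WIP_loop :: "'a neutro monoid \<Rightarrow> bool" where
  "WIP_loop N \<longleftrightarrow>
     (\<forall>x \<in> carrier N. \<forall>y \<in> carrier N. \<forall>z \<in> carrier N.
        (x \<otimes>\<^bsub>N\<^esub> y) \<otimes>\<^bsub>N\<^esub> z = \<one>\<^bsub>N\<^esub> \<longrightarrow>
          x \<otimes>\<^bsub>N\<^esub> (y \<otimes>\<^bsub>N\<^esub> z) = \<one>\<^bsub>N\<^esub> \<and>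
          (times_I x \<otimes>\<^bsub>N\<^esub> times_I y) \<otimes>\<^bsub>N\<^esub> times_I z = times_I \<one>\<^bsub>N\<^esub> \<and>
          times_I x \<otimes>\<^bsub>N\<^esub> (times_I y \<otimes>\<^bsub>N\<^esub> times_I z) = times_I \<one>\<^bsub>N\<^esub>)"

end

theory Submission imports Defs
begin

text \<open>
  A product in the neutrosophic loop equals the identity \<open>e\<close> only if every factor is free
  of \<open>I\<close>, and applying \<open>x \<mapsto> xI\<close> to an identity between products preserves it; so the
  neutrosophic loop has the weak inverse property exactly when \<open>(xy)z = e\<close> implies
  \<open>x(yz) = e\<close> in \<open>L\<^sub>n(m)\<close> itself (\<open>WIP_neutrosophic_loop_iff\<close>).

  In \<open>L\<^sub>n(m)\<close> a product \<open>uv\<close> equals \<open>e\<close> exactly when \<open>u = v\<close>, so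
  \<open>(xy)z = e\<close> means \<open>z = xy\<close>, and the
  condition becomes \<open>x(y(xy)) = e\<close>, that is, \<open>y(xy) = x\<close>.  This is automatic if \<open>x\<close> or
  \<open>y\<close> is \<open>e\<close> or if \<open>x = y\<close>.  For distinct \<open>i\<close> and \<open>j\<close> the rule
  \<open>i \<cdot> j \<equiv> mj - (m - 1)i\<close>, applied twice, gives
  \<open>j(ij) - i \<equiv> (m\<^sup>2 - m + 1)(j - i)\<close> modulo \<open>n\<close> (\<open>Ln_mult_WIP_iff_cong\<close>).  If
  \<open>m\<^sup>2 - m + 1\<close> vanishes modulo \<open>n\<close>, so does this difference; conversely, the pair
  \<open>i = 1\<close>, \<open>j = 2\<close> forces \<open>m\<^sup>2 - m + 1\<close> to vanish.
\<close>

lemma WIP_neutrosophic_loop_iff: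
  "WIP_loop (neutrosophic_loop L) \<longleftrightarrow>
     (\<forall>x \<in> carrier L. \<forall>y \<in> carrier L. \<forall>z \<in> carrier L.
        (x \<otimes>\<^bsub>L\<^esub> y) \<otimes>\<^bsub>L\<^esub> z = \<one>\<^bsub>L\<^esub> \<longrightarrow> x \<otimes>\<^bsub>L\<^esub> (y \<otimes>\<^bsub>L\<^esub> z) = \<one>\<^bsub>L\<^esub>)"
  (is "?N \<longleftrightarrow> ?W")
proof
  assume N: ?N
  show ?W
  proof (intro ballI impI)
    fix x y z
    assume "x \<in> carrier L" "y \<in> carrier L" "z \<in> carrier L"
      and "(x \<otimes>\<^bsub>L\<^esub> y) \<otimes>\<^bsub>L\<^esub> z = \<one>\<^bsub>L\<^esub>"
    thus "x \<otimes>\<^bsub>L\<^esub> (y \<otimes>\<^bsub>L\<^esub> z) = \<one>\<^bsub>L\<^esub>"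
      using N[unfolded WIP_loop_def, rule_format, of "Pure x" "Pure y" "Pure z"]
      by (simp add: neutrosophic_loop_def)
  qed
next
  assume W: ?W
  show ?N
    unfolding WIP_loop_def
  proof (intro ballI impI)
    fix x y z
    assume "x \<in> carrier (neutrosophic_loop L)" "y \<in> carrier (neutrosophic_loop L)"
      "z \<in> carrier (neutrosophic_loop L)"
      and "(x \<otimes>\<^bsub>neutrosophic_loop L\<^esub> y) \<otimes>\<^bsub>neutrosophic_loop L\<^esub> z = \<one>\<^bsub>neutrosophic_loop L\<^esub>"
    thus "x \<otimes>\<^bsub>neutrosophic_loop L\<^esub> (y \<otimes>\<^bsub>neutrosophic_loop L\<^esub> z) = \<one>\<^bsub>neutrosophic_loop L\<^esub> \<and>
      (times_I x \<otimes>\<^bsub>neutrosophic_loop L\<^esub> times_I y) \<otimes>\<^bsub>neutrosophic_loop L\<^esub> times_I z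
        = times_I \<one>\<^bsub>neutrosophic_loop L\<^esub> \<and>
      times_I x \<otimes>\<^bsub>neutrosophic_loop L\<^esub> (times_I y \<otimes>\<^bsub>neutrosophic_loop L\<^esub> times_I z)
        = times_I \<one>\<^bsub>neutrosophic_loop L\<^esub>"
      using W by (cases x; cases y; cases z) (auto simp: neutrosophic_loop_def)
  qed
qed

lemma cong_imp_eq_atLeastAtMost:
  assumes "a \<in> {1..n}" "b \<in> {1..n}" "[int a = int b] (mod int n)"
  shows "a = b"
proof (rule ccontr)
  assume "a \<noteq> b"
  have "int n dvd int a - int b"
    using assms(3) by (simp add: cong_iff_dvd_diff)
  moreover have "int a - int b \<noteq> 0" using \<open>a \<noteq> b\<close> by simp
  ultimately have "int n \<le> \<bar>int a - int b\<bar>"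
    using dvd_imp_le_int[of "int a - int b" "int n"] by simp
  thus False using assms(1,2) by auto
qed

lemma ex1_representative_atLeastAtMost:
  assumes "n > 0"
  shows "\<exists>!s. s \<in> {1..n} \<and> [int s = k] (mod int n)"
proof -
  \<comment> \<open>Shifting by one moves the least nonnegative residues onto \<open>{1..n}\<close>.\<close>
  define s where "s = nat ((k - 1) mod int n) + 1"
  have r: "0 \<le> (k - 1) mod int n" "(k - 1) mod int n < int n" using assms by auto
  hence s: "s \<in> {1..n}" by (auto simp: s_def)
  have "int s = (k - 1) mod int n + 1" using r by (simp add: s_def)
  moreover have "[(k - 1) mod int n + 1 = (k - 1) + 1] (mod int n)"
    by (intro cong_add) auto
  ultimately have "[int s = k] (mod int n)" by simp
  with s show ?thesis
    by (metis cong_imp_eq_atLeastAtMost cong_sym cong_trans)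
qed

text \<open>Each residue class modulo \<open>n\<close> has exactly one member in \<open>{1..n}\<close>, so the
  definite description in \<open>Ln_mult\<close> denotes; from here on only the congruence that it
  satisfies matters.\<close>

lemma Ln_mult_Num_obtain:
  assumes "n > 0" "i \<noteq> j"
  obtains s where "Ln_mult n m (Num i) (Num j) = Num s" "s \<in> {1..n}"
    "[int s = int m * int j - (int m - 1) * int i] (mod int n)"
proof (rule that)
  let ?P = "\<lambda>s. s \<in> {1..n} \<and> [int s = int m * int j - (int m - 1) * int i] (mod int n)"
  show "Ln_mult n m (Num i) (Num j) = Num (THE s. ?P s)"
    unfolding Ln_mult.simps(3) using assms(2) by (rule if_not_P)
  have "?P (THE s. ?P s)"
    using ex1_representative_atLeastAtMost[OF assms(1)] by (rule theI')
  thus "(THE s. ?P s) \<in> {1..n}"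
    and "[int (THE s. ?P s) = int m * int j - (int m - 1) * int i] (mod int n)"
    by blast+
qed

lemma Ln_mult_eq_E_iff: "Ln_mult n m x y = E \<longleftrightarrow> x = y"
  by (cases x; cases y) auto

text \<open>This is the weak inverse property for the single triple \<open>i\<close>, \<open>j\<close>, \<open>ij\<close>: the
  linear rule, applied twice, turns \<open>j(ij) = i\<close> into a linear congruence in \<open>j - i\<close>.\<close>

lemma Ln_mult_WIP_iff_cong:
  assumes n: "n > 0" and i: "i \<in> {1..n}" and j: "j \<in> {1..n}" and ij: "i \<noteq> j"
    and cop: "coprime (int m - 1) (int n)"
  shows "Ln_mult n m (Num j) (Ln_mult n m (Num i) (Num j)) = Num i \<longleftrightarrow>
    [((int m)^2 - int m + 1) * (int j - int i) = 0] (mod int n)"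
proof -
  obtain s where s: "Ln_mult n m (Num i) (Num j) = Num s" "s \<in> {1..n}"
    "[int s = int m * int j - (int m - 1) * int i] (mod int n)"
    using Ln_mult_Num_obtain[OF n ij] .
  \<comment> \<open>\<open>ij - j \<equiv> (m - 1)(j - i)\<close>, so \<open>ij = j\<close> would give \<open>i = j\<close>; hence the
    product \<open>j(ij)\<close> is again given by the linear rule.\<close>
  have "j \<noteq> s"
  proof
    assume "j = s"
    have "int n dvd int s - (int m * int j - (int m - 1) * int i)"
      using s(3) by (simp add: cong_iff_dvd_diff)
    also have "int s - (int m * int j - (int m - 1) * int i) = (int m - 1) * (int i - int j)"
      using \<open>j = s\<close> by (simp add: algebra_simps)
    finally have "int n dvd int i - int j"
      using cop by (simp add: coprime_dvd_mult_right_iff coprime_commute)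
    hence "i = j" using cong_imp_eq_atLeastAtMost[OF i j] by (simp add: cong_iff_dvd_diff)
    thus False using ij by simp
  qed
  then obtain t where t: "Ln_mult n m (Num j) (Num s) = Num t" "t \<in> {1..n}"
    "[int t = int m * int s - (int m - 1) * int j] (mod int n)"
    using Ln_mult_Num_obtain[OF n] by metis
  have "[int m * int s - (int m - 1) * int j
      = int m * (int m * int j - (int m - 1) * int i) - (int m - 1) * int j] (mod int n)"
    by (intro cong_diff cong_mult cong_refl s(3))
  with t(3) have "[int t - int i
      = int m * (int m * int j - (int m - 1) * int i) - (int m - 1) * int j - int i] (mod int n)"
    by (intro cong_diff cong_refl) (rule cong_trans)
  also have "int m * (int m * int j - (int m - 1) * int i) - (int m - 1) * int j - int i
      = ((int m)^2 - int m + 1) * (int j - int i)"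
    by (simp add: algebra_simps power2_eq_square)
  finally have diff: "[int t - int i = ((int m)^2 - int m + 1) * (int j - int i)] (mod int n)" .
  have "t = i \<longleftrightarrow> [int t - int i = 0] (mod int n)"
    using cong_imp_eq_atLeastAtMost[OF t(2) i] by (auto simp: cong_diff_iff_cong_0)
  also have "\<dots> \<longleftrightarrow> [((int m)^2 - int m + 1) * (int j - int i) = 0] (mod int n)"
    using diff by (meson cong_sym cong_trans)
  finally show ?thesis using s(1) t(1) by simp
qed

theorem theorem4p1p13:
  fixes n m :: nat
  assumes "n > 3" and "odd n" and "0 < m" and "m < n"
    and "gcd m n = 1" and "gcd (m - 1) n = 1"
  shows "WIP_loop (neutrosophic_loop (Ln n m)) \<longleftrightarrow> [(int m)^2 - int m + 1 = 0] (mod int n)"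
proof -
  let ?q = "(int m)^2 - int m + 1"
  have n: "n > 0" using assms(1) by simp
  have "coprime (int (m - 1)) (int n)" using assms(6) by (simp add: coprime_iff_gcd_eq_1)
  hence cop: "coprime (int m - 1) (int n)" using assms(3) by simp
  have "WIP_loop (neutrosophic_loop (Ln n m)) \<longleftrightarrow>
      (\<forall>x \<in> carrier (Ln n m). \<forall>y \<in> carrier (Ln n m). \<forall>z \<in> carrier (Ln n m).
        Ln_mult n m x y = z \<longrightarrow> Ln_mult n m y z = x)"
    unfolding WIP_neutrosophic_loop_iff by (auto simp: Ln_def Ln_mult_eq_E_iff)
  also have "\<dots> \<longleftrightarrow> (\<forall>i \<in> {1..n}. \<forall>j \<in> {1..n}. i \<noteq> j \<longrightarrow>
        Ln_mult n m (Num j) (Ln_mult n m (Num i) (Num j)) = Num i)"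
    (is "?loop \<longleftrightarrow> ?distinct")
  proof
    assume L: ?loop
    show ?distinct
    proof (intro ballI impI)
      fix i j assume ij: "i \<in> {1..n}" "j \<in> {1..n}" "i \<noteq> j"
      obtain s where "Ln_mult n m (Num i) (Num j) = Num s" "s \<in> {1..n}"
        using Ln_mult_Num_obtain[OF n ij(3)] by metis
      thus "Ln_mult n m (Num j) (Ln_mult n m (Num i) (Num j)) = Num i"
        using L[rule_format, of "Num i" "Num j" "Num s"] ij
        by (simp add: Ln_def del: Ln_mult.simps)
    qed
  next
    assume D: ?distinct
    have "Ln_mult n m y (Ln_mult n m x y) = x"
      if "x \<in> carrier (Ln n m)" "y \<in> carrier (Ln n m)" for x y
    proof (cases "x = E \<or> y = E \<or> x = y")
      case True
      thus ?thesis by (cases x; cases y) auto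
    next
      case False
      thus ?thesis using D that by (auto simp: Ln_def simp del: Ln_mult.simps(3))
    qed
    thus ?loop by blast
  qed
  also have "\<dots> \<longleftrightarrow> (\<forall>i \<in> {1..n}. \<forall>j \<in> {1..n}. i \<noteq> j \<longrightarrow> [?q * (int j - int i) = 0] (mod int n))"
    using Ln_mult_WIP_iff_cong[OF n _ _ _ cop] by blast
  also have "\<dots> \<longleftrightarrow> [?q = 0] (mod int n)"
  proof
    assume "\<forall>i \<in> {1..n}. \<forall>j \<in> {1..n}. i \<noteq> j \<longrightarrow> [?q * (int j - int i) = 0] (mod int n)"
    from this[rule_format, of 1 2] show "[?q = 0] (mod int n)" using assms(1) by simp
  next
    assume "[?q = 0] (mod int n)"
    thus "\<forall>i \<in> {1..n}. \<forall>j \<in> {1..n}. i \<noteq> j \<longrightarrow> [?q * (int j - int i) = 0] (mod int n)"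
      by (simp add: cong_0_iff)
  qed
  finally show ?thesis .
qed

end
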